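(* Let $n\ge1$ be an integer, let $0=\nu_1\le\nu_2\le\cdots\le\nu_n$ be fixed integers, and put $\alpha_n=\sum_{i=1}^n\nu_i$. Then for every $z\in\mathbb{C}$, for large enough $N$, one has the asymptotic relation $$\omega_{n,N}(z)\sim\frac{(2\pi)^{\frac32(n-1)}}{2^{n-1}N^{\frac{n-1}2}\sqrt n}\;\frac{|z|^{\frac{1-n+2\alpha_n}{n}}}{\big(1+|z|^{\frac2n}\big)^{nN+\alpha_n+1}},$$ where $\sim$ denotes asymptotic equivalence as $N\to+\infty$.
   Context: For integers $n,N\ge1$ and $0=\nu_1\le\cdots\le\nu_n$, the weight $\omega_{n,N}$ is $$\omega_{n,N}(z)=\int_{\mathbb{C}^n}\prod_{j=1}^n\frac{|x_j|^{2\nu_j}}{(1+|x_j|^2)^{\nu_j+N+1}}\;\delta\Big(z-\prod_{j=1}^n x_j\Big)\,d^2x_1\cdots d^2x_n ,$$ where $d^2x$ is Lebesgue measure on $\mathbb{C}$ and $\delta$ is the Dirac delta on $\mathbb{C}$; in polar coordinates this is written $$\omega_{n,N}(z)=(2\pi)^{n-1}\int_{(0,\infty)^{n-1}}\frac{|z|^{2\nu_n}}{\big(1+\frac{|z|^2}{r_1^2\cdots r_{n-1}^2}\big)^{\nu_n+N+1}}\prod_{j=1}^{n-1}\frac{r_j^{2\nu_j-2\nu_n-1}}{(1+r_j^2)^{\nu_j+N+1}}\,dr_1\cdots dr_{n-1}$$ (for $n=1$ there is no integration and $\omega_{1,N}(z)=(1+|z|^2)^{-N-1}$).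
   Formalization: The point z=0 is excluded when n≥2: there the claim fails or is undefined (for n=2, ν=(0,1) the right side is 0 while ω(0), taken as the limit z→0, is π/(N+1)>0; for all ν_j=0 both sides are infinite); z=0 with n=1 is kept. *)

theory Defs
  imports "HOL-Analysis.Analysis" "HOL-Library.Landau_Symbols"
begin

text \<open>
  The weight, in the polar-coordinate form that gives the delta integral a value at each point:
  the delta function eliminates \<open>x\<^sub>n = z / (x\<^sub>1 \<cdots> x\<^sub>n\<^sub>-\<^sub>1)\<close>, with Jacobian
  \<open>1 / \<bar>x\<^sub>1 \<cdots> x\<^sub>n\<^sub>-\<^sub>1\<bar>\<^sup>2\<close>, and the angular integrals contribute \<open>(2 * pi) ^ (n - 1)\<close>.
  The \<open>\<nu>\<close>'s are indexed from 1 to \<open>n\<close>. For \<open>n = 1\<close> the index set is empty and the product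
  measure is a unit point mass, so no separate case is needed; see \<open>omega_1\<close>.
  For \<open>z = 0\<close> and \<open>n \<ge> 2\<close> the integrand is identically 0 (if \<open>\<nu> n > 0\<close>) or not integrable
  (if \<open>\<nu> n = 0\<close>); the value 0 obtained there carries no meaning.
\<close>

definition omega :: "nat \<Rightarrow> (nat \<Rightarrow> nat) \<Rightarrow> nat \<Rightarrow> complex \<Rightarrow> real" where
  "omega n \<nu> N z =
     (2 * pi) ^ (n - 1) *
     (LINT r : (\<Pi>\<^sub>E j\<in>{1..n-1}. {0<..}) | (\<Pi>\<^sub>M j\<in>{1..n-1}. lborel).
        cmod z ^ (2 * \<nu> n) / (1 + (cmod z)\<^sup>2 / (\<Prod>j\<in>{1..n-1}. (r j)\<^sup>2)) ^ (\<nu> n + N + 1) *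
        (\<Prod>j\<in>{1..n-1}. r j powi (2 * int (\<nu> j) - 2 * int (\<nu> n) - 1) /
                          (1 + (r j)\<^sup>2) ^ (\<nu> j + N + 1)))"

lemma omega_1:
  assumes "\<nu> 1 = 0"
  shows "omega 1 \<nu> N z = 1 / (1 + (cmod z)\<^sup>2) ^ (N + 1)"
  using assms
  by (simp add: omega_def set_lebesgue_integral_def PiM_empty lebesgue_integral_count_space_finite)

text \<open>
  Real powers with \<open>0\<^sup>0 = 1\<close>, whereas \<open>0 powr 0 = 0\<close>.
\<close>

definition rpow :: "real \<Rightarrow> real \<Rightarrow> real" where
  "rpow x a = (if a = 0 then 1 else x powr a)"

end

theory Submission
  imports Defs "HOL-Probability.Sinc_Integral" "HOL-Real_Asymp.Real_Asymp"
begin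

text \<open>
  Laplace's method. For \<open>n \<ge> 2\<close> and \<open>z \<noteq> 0\<close> put \<open>c = ln (cmod z) / n\<close> and substitute
  \<open>r\<^sub>j = exp (c + s\<^sub>j / sqrt N)\<close>; then \<open>r\<^sub>n = cmod z / (r\<^sub>1 \<cdots> r\<^sub>n\<^sub>-\<^sub>1)\<close> corresponds to
  \<open>s\<^sub>n = - (s\<^sub>1 + \<cdots> + s\<^sub>n\<^sub>-\<^sub>1)\<close>, and the integrand becomes a symmetric product of \<open>n\<close> factors.
  Since the \<open>s\<^sub>j\<close> sum to 0, each \<open>1 / (1 + exp (2 * t)) ^ N\<close> may be multiplied by the exponential
  that makes its logarithm stationary at \<open>t = c\<close>. The tilted factors are bounded by
  \<open>1 / (1 + \<kappa> * s\<^sup>2)\<close> uniformly in \<open>N\<close> and converge pointwise to Gaussians, so by dominated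
  convergence the integral tends to a Gaussian integral with quadratic form
  \<open>s\<^sub>1\<^sup>2 + \<cdots> + s\<^sub>n\<^sub>-\<^sub>1\<^sup>2 + (s\<^sub>1 + \<cdots> + s\<^sub>n\<^sub>-\<^sub>1)\<^sup>2\<close>, whose determinant is \<open>n\<close>.
\<close>

section \<open>Exponential substitution in one and in several variables\<close>

text \<open>The substitution rule on compact intervals is applied on
  \<open>{- real k..real k}\<close>. These intervals exhaust the line and their images under
  \<open>h\<close> exhaust \<open>{0<..}\<close>, so monotone convergence on both sides gives the
  identity. With values in \<open>ennreal\<close> no integrability of \<open>F\<close> has to be
  known.\<close>

lemma nn_integral_exp_affine_substitution:
  fixes F :: "real \<Rightarrow> ennreal"
  assumes [measurable]: "F \<in> borel_measurable borel" and \<sigma>: "\<sigma> > 0"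
  shows "(\<integral>\<^sup>+r. F r * indicator {0<..} r \<partial>lborel) =
         (\<integral>\<^sup>+s. F (exp (c + \<sigma> * s)) * ennreal (\<sigma> * exp (c + \<sigma> * s)) \<partial>lborel)"
proof -
  define h where "h s = exp (c + \<sigma> * s)" for s
  have h_mono: "h s \<le> h t" if "s \<le> t" for s t
    using that \<sigma> by (simp add: h_def)
  have [measurable]: "h \<in> borel_measurable borel"
    unfolding h_def by measurable
  have inc1: "incseq (\<lambda>k r. F r * indicator {h (- real k)..h (real k)} r)"
  proof (intro incseq_SucI le_funI mult_left_mono)
    fix k r
    show "(indicator {h (- real k)..h (real k)} r :: ennreal) \<le>
            indicator {h (- real (Suc k))..h (real (Suc k))} r"
      using h_mono[of "real k" "real (Suc k)"] h_mono[of "- real (Suc k)" "- real k"]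
      by (auto simp: indicator_def)
  qed auto
  have inc2: "incseq (\<lambda>k s. F (h s) * ennreal (\<sigma> * h s) * indicator {- real k..real k} s)"
    by (intro incseq_SucI le_funI mult_left_mono) (auto simp: indicator_def)
  have pt1: "(SUP k. F r * indicator {h (- real k)..h (real k)} r) = F r * indicator {0<..} r" for r
  proof -
    have "(SUP k. (indicator {h (- real k)..h (real k)} r :: ennreal)) = indicator {0<..} r"
    proof (cases "r > 0")
      case True
      define s where "s = (ln r - c) / \<sigma>"
      have s: "h s = r" using True \<sigma> by (simp add: h_def s_def)
      obtain k where k: "\<bar>s\<bar> \<le> real k" using real_arch_simple by blast
      have "h (- real k) \<le> h s" "h s \<le> h (real k)" using k by (auto intro!: h_mono)
      then have "indicator {h (- real k)..h (real k)} r = (1::ennreal)" using s by simp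
      then have "(1::ennreal) \<le> (SUP k. indicator {h (- real k)..h (real k)} r)"
        by (intro SUP_upper2[of k]) auto
      moreover have "(SUP k. indicator {h (- real k)..h (real k)} r) \<le> (1::ennreal)"
        by (intro SUP_least) (auto simp: indicator_def)
      ultimately have "(SUP k. indicator {h (- real k)..h (real k)} r) = (1::ennreal)"
        by (rule order_antisym[rotated])
      then show ?thesis using True by simp
    next
      case False
      then have "r < h t" for t unfolding h_def by (meson exp_gt_zero not_less order_le_less_trans)
      then have "indicator {h (- real k)..h (real k)} r = (0::ennreal)" for k
        by (simp add: indicator_def not_le)
      then show ?thesis using False by simp
    qed
    then show ?thesis by (simp only: SUP_mult_left_ennreal[symmetric] mult_1_right)
  qed
  have pt2: "(SUP k. F (h s) * ennreal (\<sigma> * h s) * indicator {- real k..real k} s) =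
      F (h s) * ennreal (\<sigma> * h s)" for s
  proof -
    obtain k where "\<bar>s\<bar> \<le> real k" using real_arch_simple by blast
    then have "indicator {- real k..real k} s = (1::ennreal)" by (auto simp: indicator_def)
    then have "(1::ennreal) \<le> (SUP k. indicator {- real k..real k} s)"
      by (intro SUP_upper2[of k]) auto
    moreover have "(SUP k. indicator {- real k..real k} s) \<le> (1::ennreal)"
      by (intro SUP_least) (auto simp: indicator_def)
    ultimately have "(SUP k. indicator {- real k..real k} s) = (1::ennreal)" by (rule order_antisym[rotated])
    then show ?thesis by (simp only: SUP_mult_left_ennreal[symmetric] mult_1_right)
  qed
  have sub: "(\<integral>\<^sup>+r. F r * indicator {h (- real k)..h (real k)} r \<partial>lborel) =
      (\<integral>\<^sup>+s. F (h s) * ennreal (\<sigma> * h s) * indicator {- real k..real k} s \<partial>lborel)" for k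
  proof (cases "k = 0")
    \<comment> \<open>The substitution rule wants a proper interval; for \<open>k = 0\<close> both
      integrals run over a single point and vanish.\<close>
    case True
    have "(\<integral>\<^sup>+r. F r * indicator {x} r \<partial>lborel) = 0" for x
      by (subst nn_integral_0_iff_AE) (use AE_lborel_singleton[of x] in \<open>auto elim!: eventually_mono\<close>)
    moreover have "(\<integral>\<^sup>+s. F (h s) * ennreal (\<sigma> * h s) * indicator {0} s \<partial>lborel) = 0"
      by (subst nn_integral_0_iff_AE) (use AE_lborel_singleton[of 0] in \<open>auto elim!: eventually_mono\<close>)
    ultimately show ?thesis using True by simp
  next
    case False
    show ?thesis
    proof (rule nn_integral_substitution_aux)
      show "(h has_real_derivative \<sigma> * h s) (at s)" for s
        unfolding h_def by (auto intro!: derivative_eq_intros)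
      show "continuous_on {- real k..real k} (\<lambda>s. \<sigma> * h s)"
        unfolding h_def by (intro continuous_intros)
      show "0 \<le> \<sigma> * h s" for s
        using \<sigma> by (simp add: h_def)
    qed (use False in auto)
  qed
  have "(\<integral>\<^sup>+r. F r * indicator {0<..} r \<partial>lborel) =
      (SUP k. \<integral>\<^sup>+r. F r * indicator {h (- real k)..h (real k)} r \<partial>lborel)"
    unfolding pt1[symmetric] by (rule nn_integral_monotone_convergence_SUP[OF inc1]) measurable
  also have "\<dots> = (SUP k. \<integral>\<^sup>+s. F (h s) * ennreal (\<sigma> * h s) * indicator {- real k..real k} s \<partial>lborel)"
    by (simp add: sub)
  also have "\<dots> = (\<integral>\<^sup>+s. (SUP k. F (h s) * ennreal (\<sigma> * h s) * indicator {- real k..real k} s) \<partial>lborel)"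
    by (rule nn_integral_monotone_convergence_SUP[OF inc2, symmetric]) measurable
  also have "\<dots> = (\<integral>\<^sup>+s. F (h s) * ennreal (\<sigma> * h s) \<partial>lborel)"
    by (simp only: pt2)
  finally show ?thesis by (simp add: h_def)
qed

text \<open>By Tonelli one coordinate is split off and substituted while the others are frozen. The
  resulting inner integral \<open>G\<close> is a function of the remaining coordinates, and the
  induction hypothesis is applied to it; hence the induction over arbitrary
  \<open>F\<close>.\<close>

lemma nn_integral_PiM_exp_affine_substitution:
  fixes F :: "('i \<Rightarrow> real) \<Rightarrow> ennreal"
  assumes "finite I" and "F \<in> borel_measurable (PiM I (\<lambda>_. lborel))" and \<sigma>: "\<sigma> > 0"
  shows "(\<integral>\<^sup>+r. F r * (\<Prod>j\<in>I. indicator {0<..} (r j)) \<partial>PiM I (\<lambda>_. lborel)) =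
         (\<integral>\<^sup>+s. F (\<lambda>j\<in>I. exp (c + \<sigma> * s j)) * (\<Prod>j\<in>I. ennreal (\<sigma> * exp (c + \<sigma> * s j)))
            \<partial>PiM I (\<lambda>_. lborel))"
  using assms(1,2)
proof (induction I arbitrary: F rule: finite_induct)
  case empty
  interpret product_sigma_finite "\<lambda>_::'i. lborel :: real measure" ..
  show ?case by (simp add: PiM_empty nn_integral_count_space_finite)
next
  case (insert i I F)
  interpret product_sigma_finite "\<lambda>_::'i. lborel :: real measure" ..
  note [measurable] = insert.prems
  have [measurable]: "(\<lambda>x. x j) \<in> borel_measurable (PiM (insert i I) (\<lambda>_. lborel))"
    if "j \<in> insert i I" for j using measurable_component_singleton[OF that, of "\<lambda>_. lborel"] by simp
  define h where "h s = exp (c + \<sigma> * s)" for s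
  have [measurable]: "h \<in> borel_measurable borel" unfolding h_def by measurable
  define G where "G x = (\<integral>\<^sup>+y. F (x(i := h y)) * ennreal (\<sigma> * h y) \<partial>lborel)" for x
  have prod_eq: "(\<Prod>j\<in>I. f ((x(i := y)) j)) = (\<Prod>j\<in>I. f (x j))"
    for f :: "real \<Rightarrow> ennreal" and x and y
    using insert.hyps by (intro prod.cong) auto
  have "(\<integral>\<^sup>+r. F r * (\<Prod>j\<in>insert i I. indicator {0<..} (r j)) \<partial>PiM (insert i I) (\<lambda>_. lborel)) =
      (\<integral>\<^sup>+x. \<integral>\<^sup>+y. F (x(i := y)) * (\<Prod>j\<in>insert i I. indicator {0<..} ((x(i := y)) j)) \<partial>lborel
        \<partial>PiM I (\<lambda>_. lborel))"
    by (rule product_nn_integral_insert[OF insert.hyps]) measurable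
  also have "\<dots> = (\<integral>\<^sup>+x. G x * (\<Prod>j\<in>I. indicator {0<..} (x j)) \<partial>PiM I (\<lambda>_. lborel))"
  proof (intro nn_integral_cong)
    fix x assume x: "x \<in> space (PiM I (\<lambda>_. lborel :: real measure))"
    have [measurable]: "(\<lambda>y. x(i := y)) \<in> measurable borel (PiM (insert i I) (\<lambda>_. lborel))"
      by (rule measurable_fun_upd[where J = I]) (use x in auto)
    define P :: ennreal where "P = (\<Prod>j\<in>I. indicator {0<..} (x j))"
    have "(\<integral>\<^sup>+y. F (x(i := y)) * (\<Prod>j\<in>insert i I. indicator {0<..} ((x(i := y)) j)) \<partial>lborel) =
        (\<integral>\<^sup>+y. F (x(i := y)) * P * indicator {0<..} y \<partial>lborel)"
      using insert.hyps
      by (intro nn_integral_cong) (simp add: P_def prod_eq[of "indicator {0<..}"] del: fun_upd_apply, simp add: mult_ac)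
    also have "\<dots> = (\<integral>\<^sup>+y. F (x(i := h y)) * P * ennreal (\<sigma> * h y) \<partial>lborel)"
      unfolding h_def by (rule nn_integral_exp_affine_substitution[OF _ \<sigma>]) measurable
    also have "\<dots> = G x * P"
      unfolding G_def by (subst nn_integral_multc[symmetric]) (simp_all add: mult_ac)
    finally show "(\<integral>\<^sup>+y. F (x(i := y)) * (\<Prod>j\<in>insert i I. indicator {0<..} ((x(i := y)) j)) \<partial>lborel) =
        G x * (\<Prod>j\<in>I. indicator {0<..} (x j))"
      by (simp add: P_def)
  qed
  also have "\<dots> = (\<integral>\<^sup>+s. G (\<lambda>j\<in>I. h (s j)) * (\<Prod>j\<in>I. ennreal (\<sigma> * h (s j))) \<partial>PiM I (\<lambda>_. lborel))"
    unfolding h_def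
  proof (rule insert.IH)
    show "G \<in> borel_measurable (PiM I (\<lambda>_. lborel))"
      unfolding G_def by measurable
  qed
  also have "\<dots> = (\<integral>\<^sup>+x. \<integral>\<^sup>+y. F (\<lambda>j\<in>insert i I. h ((x(i := y)) j)) *
      (\<Prod>j\<in>insert i I. ennreal (\<sigma> * h ((x(i := y)) j))) \<partial>lborel \<partial>PiM I (\<lambda>_. lborel))"
  proof (intro nn_integral_cong)
    fix x assume x: "x \<in> space (PiM I (\<lambda>_. lborel :: real measure))"
    have hx: "(\<lambda>j\<in>I. h (x j)) \<in> space (PiM I (\<lambda>_. lborel :: real measure))"
      by (auto simp: space_PiM)
    have [measurable]: "(\<lambda>y. (\<lambda>j\<in>I. h (x j))(i := y)) \<in> measurable borel (PiM (insert i I) (\<lambda>_. lborel))"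
      by (rule measurable_fun_upd[where J = I]) (use hx in auto)
    have upd: "(\<lambda>j\<in>insert i I. h ((x(i := y)) j)) = (\<lambda>j\<in>I. h (x j))(i := h y)" for y
      using insert.hyps by (auto simp: fun_eq_iff restrict_def)
    have "(\<Prod>j\<in>insert i I. ennreal (\<sigma> * h ((x(i := y)) j))) =
        ennreal (\<sigma> * h y) * (\<Prod>j\<in>I. ennreal (\<sigma> * h (x j)))" for y
      using insert.hyps by (subst prod.insert) (auto intro!: arg_cong2[of _ _ _ _ "(*)"] prod.cong)
    then show "G (\<lambda>j\<in>I. h (x j)) * (\<Prod>j\<in>I. ennreal (\<sigma> * h (x j))) =
        (\<integral>\<^sup>+y. F (\<lambda>j\<in>insert i I. h ((x(i := y)) j)) *
          (\<Prod>j\<in>insert i I. ennreal (\<sigma> * h ((x(i := y)) j))) \<partial>lborel)"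
      unfolding upd G_def by (subst nn_integral_multc[symmetric]) (simp_all add: mult_ac)
  qed
  also have "\<dots> = (\<integral>\<^sup>+s. F (\<lambda>j\<in>insert i I. h (s j)) * (\<Prod>j\<in>insert i I. ennreal (\<sigma> * h (s j)))
      \<partial>PiM (insert i I) (\<lambda>_. lborel))"
    by (rule product_nn_integral_insert[OF insert.hyps, symmetric]) measurable
  finally show ?case unfolding h_def .
qed

section \<open>Gaussian integrals\<close>

text \<open>Completing the square in \<open>s\<close>: the exponent has its vertex at \<mu> and
  width \<sigma>, and its minimum over \<open>s\<close> leaves the term with
  \<open>b / (1 + b) * y\<^sup>2\<close>. What remains is a multiple of a normal density.\<close>

lemma nn_integral_gaussian_shift:
  assumes a: "a > 0" and b: "b \<ge> 0"
  shows "(\<integral>\<^sup>+s. ennreal (exp (- (a / 2 * (s\<^sup>2 + b * (s + y)\<^sup>2)))) \<partial>lborel) =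
         ennreal (sqrt (2 * pi / (a * (1 + b))) * exp (- (a / 2 * (b / (1 + b) * y\<^sup>2))))"
proof -
  define \<mu> where "\<mu> = - (b * y / (1 + b))"
  define \<sigma> where "\<sigma> = sqrt (1 / (a * (1 + b)))"
  have \<sigma>: "\<sigma> > 0" and \<sigma>2: "\<sigma>\<^sup>2 = 1 / (a * (1 + b))"
    using a b by (auto simp: \<sigma>_def)
  define C where "C = sqrt (2 * pi / (a * (1 + b))) * exp (- (a / 2 * (b / (1 + b) * y\<^sup>2)))"
  have "C \<ge> 0" using a b by (simp add: C_def)
  have sq: "a / 2 * (s\<^sup>2 + b * (s + y)\<^sup>2) = (s - \<mu>)\<^sup>2 / (2 * \<sigma>\<^sup>2) + a / 2 * (b / (1 + b) * y\<^sup>2)" for s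
    using a b unfolding \<mu>_def \<sigma>2
    by (simp add: divide_simps add_nonneg_eq_0_iff) algebra
  have "exp (- (a / 2 * (s\<^sup>2 + b * (s + y)\<^sup>2))) = C * normal_density \<mu> \<sigma> s" for s
  proof -
    have "sqrt (2 * pi * \<sigma>\<^sup>2) = sqrt (2 * pi / (a * (1 + b)))" by (simp add: \<sigma>2)
    moreover have "sqrt (2 * pi / (a * (1 + b))) > 0" using a b by simp
    ultimately show ?thesis
      unfolding C_def normal_density_def sq minus_add_distrib exp_add using a b by simp
  qed
  then have "(\<integral>\<^sup>+s. ennreal (exp (- (a / 2 * (s\<^sup>2 + b * (s + y)\<^sup>2)))) \<partial>lborel) =
      ennreal C * (\<integral>\<^sup>+s. ennreal (normal_density \<mu> \<sigma> s) \<partial>lborel)"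
    using \<open>C \<ge> 0\<close> by (simp add: ennreal_mult nn_integral_cmult)
  also have "(\<integral>\<^sup>+s. ennreal (normal_density \<mu> \<sigma> s) \<partial>lborel) = 1"
    using \<sigma> by (subst nn_integral_eq_integral) auto
  finally show ?thesis by (simp add: C_def)
qed

text \<open>
  Integrating out one variable reproduces an integrand of the same shape, with \<open>b\<close> replaced by
  \<open>b / (1 + b)\<close>; the shift \<open>y\<close> absorbs the remaining variables.
\<close>

lemma nn_integral_PiM_gaussian:
  assumes "finite I" and a: "a > 0" and "b \<ge> 0"
  shows "(\<integral>\<^sup>+s. ennreal (exp (- (a / 2 * ((\<Sum>j\<in>I. (s j)\<^sup>2) + b * (y + (\<Sum>j\<in>I. s j))\<^sup>2))))
            \<partial>PiM I (\<lambda>_. lborel)) =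
         ennreal (sqrt (2 * pi / a) ^ card I / sqrt (1 + real (card I) * b) *
            exp (- (a / 2 * (b / (1 + real (card I) * b) * y\<^sup>2))))"
  using assms(1,3)
proof (induction I arbitrary: b y rule: finite_induct)
  case empty
  then show ?case by (simp add: PiM_empty nn_integral_count_space_finite)
next
  case (insert i I b y)
  interpret product_sigma_finite "\<lambda>_::'a. lborel :: real measure" ..
  have [measurable]: "(\<lambda>x. x j) \<in> borel_measurable (PiM (insert i I) (\<lambda>_. lborel))"
    if "j \<in> insert i I" for j using measurable_component_singleton[OF that, of "\<lambda>_. lborel"] by simp
  have [measurable]: "(\<lambda>x. x j) \<in> borel_measurable (PiM I (\<lambda>_. lborel))"
    if "j \<in> I" for j using measurable_component_singleton[OF that, of "\<lambda>_. lborel"] by simp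
  define b' where "b' = b / (1 + b)"
  have b': "b' \<ge> 0" using insert.prems by (simp add: b'_def)
  define D where "D = sqrt (2 * pi / (a * (1 + b)))"
  have D: "D \<ge> 0" using a insert.prems by (simp add: D_def)
  let ?m = "real (card I)"
  have "(\<integral>\<^sup>+s. ennreal (exp (- (a / 2 * ((\<Sum>j\<in>insert i I. (s j)\<^sup>2) + b * (y + (\<Sum>j\<in>insert i I. s j))\<^sup>2))))
            \<partial>PiM (insert i I) (\<lambda>_. lborel)) =
      (\<integral>\<^sup>+x. \<integral>\<^sup>+t. ennreal (exp (- (a / 2 * ((\<Sum>j\<in>insert i I. ((x(i := t)) j)\<^sup>2) +
          b * (y + (\<Sum>j\<in>insert i I. (x(i := t)) j))\<^sup>2)))) \<partial>lborel \<partial>PiM I (\<lambda>_. lborel))"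
    by (rule product_nn_integral_insert[OF insert.hyps]) measurable
  also have "\<dots> = (\<integral>\<^sup>+x. ennreal D * ennreal (exp (- (a / 2 * ((\<Sum>j\<in>I. (x j)\<^sup>2) +
      b' * (y + (\<Sum>j\<in>I. x j))\<^sup>2)))) \<partial>PiM I (\<lambda>_. lborel))"
  proof (intro nn_integral_cong)
    fix x :: "'a \<Rightarrow> real"
    define A where "A = (\<Sum>j\<in>I. (x j)\<^sup>2)"
    define B where "B = y + (\<Sum>j\<in>I. x j)"
    have s1: "(\<Sum>j\<in>insert i I. ((x(i := t)) j)\<^sup>2) = t\<^sup>2 + A" for t
      using insert.hyps by (auto simp: A_def intro!: sum.cong)
    have s2: "y + (\<Sum>j\<in>insert i I. (x(i := t)) j) = t + B" for t
      using insert.hyps by (auto simp: B_def intro!: sum.cong)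
    have "(\<integral>\<^sup>+t. ennreal (exp (- (a / 2 * (t\<^sup>2 + A + b * (t + B)\<^sup>2)))) \<partial>lborel) =
        (\<integral>\<^sup>+t. ennreal (exp (- (a / 2 * A))) * ennreal (exp (- (a / 2 * (t\<^sup>2 + b * (t + B)\<^sup>2)))) \<partial>lborel)"
      by (simp flip: ennreal_mult exp_add add: algebra_simps)
    also have "\<dots> = ennreal (exp (- (a / 2 * A))) * ennreal (D * exp (- (a / 2 * (b' * B\<^sup>2))))"
      unfolding D_def b'_def
      by (subst nn_integral_cmult) (simp, simp only: nn_integral_gaussian_shift[OF a insert.prems])
    also have "\<dots> = ennreal D * ennreal (exp (- (a / 2 * (A + b' * B\<^sup>2))))"
      using D by (simp flip: ennreal_mult exp_add add: algebra_simps)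
    finally show "(\<integral>\<^sup>+t. ennreal (exp (- (a / 2 * ((\<Sum>j\<in>insert i I. ((x(i := t)) j)\<^sup>2) +
          b * (y + (\<Sum>j\<in>insert i I. (x(i := t)) j))\<^sup>2)))) \<partial>lborel) =
        ennreal D * ennreal (exp (- (a / 2 * ((\<Sum>j\<in>I. (x j)\<^sup>2) + b' * (y + (\<Sum>j\<in>I. x j))\<^sup>2))))"
      unfolding s1 s2 A_def B_def .
  qed
  also have "\<dots> = ennreal D * ennreal (sqrt (2 * pi / a) ^ card I / sqrt (1 + ?m * b') *
            exp (- (a / 2 * (b' / (1 + ?m * b') * y\<^sup>2))))"
    by (subst nn_integral_cmult) (measurable, simp only: insert.IH[OF b'])
  also have "\<dots> = ennreal (D * (sqrt (2 * pi / a) ^ card I / sqrt (1 + ?m * b')) *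
            exp (- (a / 2 * (b' / (1 + ?m * b') * y\<^sup>2))))"
    using D a b' by (simp flip: ennreal_mult add: mult_ac)
  also have "b' / (1 + ?m * b') = b / (1 + real (card (insert i I)) * b)"
    using insert by (simp add: b'_def divide_simps add_nonneg_eq_0_iff) (simp add: algebra_simps)
  also have "D * (sqrt (2 * pi / a) ^ card I / sqrt (1 + ?m * b')) =
      sqrt (2 * pi / a) ^ card (insert i I) / sqrt (1 + real (card (insert i I)) * b)"
  proof -
    \<comment> \<open>The determinant factorises along the elimination: the eliminated variable
      contributes \<open>1 + b\<close>, sitting in \<open>D\<close>, and the remaining ones
      contribute \<open>1 + ?m * b'\<close>.\<close>
    have "1 + real (card (insert i I)) * b = (1 + b) * (1 + ?m * b')"
      using insert by (simp add: b'_def field_simps add_nonneg_eq_0_iff)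
    then show ?thesis
      using insert by (simp add: D_def real_sqrt_mult real_sqrt_divide)
  qed
  finally show ?case .
qed

section \<open>Tilted factors: uniform bounds and Gaussian limit\<close>

text \<open>
  The moment generating function, at \<open>2 * u\<close>, of a centred Bernoulli variable with parameter \<open>q\<close>:
  having no linear term in \<open>u\<close>, it grows at least quadratically.
\<close>

definition tilted :: "real \<Rightarrow> real \<Rightarrow> real" where
  "tilted q u = (1 - q) * exp (- 2 * q * u) + q * exp (2 * (1 - q) * u)"

text \<open>For \<open>u \<ge> 0\<close> the growing exponential is bounded below to second order
  and the decaying one to first order; the linear terms cancel. Negative \<open>u\<close> reduces to
  this case by the symmetry that swaps \<open>q\<close> with \<open>1 - q\<close> and
  \<open>u\<close> with \<open>- u\<close>.\<close>

lemma tilted_ge: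
  assumes "0 < q" "q < 1"
  shows "tilted q u \<ge> 1 + 2 * q\<^sup>2 * (1 - q)\<^sup>2 * u\<^sup>2"
proof -
  have main: "tilted q u \<ge> 1 + 2 * q\<^sup>2 * (1 - q)\<^sup>2 * u\<^sup>2" if "0 < q" "q < 1" "u \<ge> 0" for q u :: real
  proof -
    have "exp (- 2 * q * u) \<ge> 1 - 2 * q * u" using exp_ge_add_one_self[of "- 2 * q * u"] by simp
    then have 1: "(1 - q) * exp (- 2 * q * u) \<ge> (1 - q) * (1 - 2 * q * u)"
      using that by (intro mult_left_mono) auto
    define v where "v = 2 * (1 - q) * u"
    have "exp v \<ge> 1 + v + v\<^sup>2 / 2"
      using that exp_lower_Taylor_quadratic[of v] by (simp add: v_def)
    then have 2: "q * exp v \<ge> q * (1 + v + v\<^sup>2 / 2)"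
      using that by (intro mult_left_mono) auto
    \<comment> \<open>The Taylor bounds give the coefficient \<open>2 * q * (1 - q)\<^sup>2\<close>;
      weakening \<open>q\<close> to \<open>q\<^sup>2\<close> makes it invariant under the swap of
      \<open>q\<close> and \<open>1 - q\<close>.\<close>
    have "q\<^sup>2 * ((1 - q)\<^sup>2 * u\<^sup>2) \<le> q * ((1 - q)\<^sup>2 * u\<^sup>2)"
      using that by (intro mult_right_mono) (auto simp: power2_eq_square mult_le_one)
    moreover have "(1 - q) * (1 - 2 * q * u) + q * (1 + v + v\<^sup>2 / 2) = 1 + 2 * (q * ((1 - q)\<^sup>2 * u\<^sup>2))"
      unfolding v_def by algebra
    ultimately show ?thesis using 1 2 by (simp add: tilted_def v_def mult.assoc)
  qed
  show ?thesis
  proof (cases "u \<ge> 0")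
    case False
    have "tilted (1 - q) (- u) = tilted q u" by (simp add: tilted_def algebra_simps)
    then show ?thesis using main[of "1 - q" "- u"] assms False by (simp add: mult_ac)
  qed (use assms main in auto)
qed

lemma tilted_pos: "0 < q \<Longrightarrow> q < 1 \<Longrightarrow> tilted q u > 0"
  by (simp add: tilted_def add_pos_pos)

text \<open>Bernoulli's inequality turns the quadratic lower bound at the scale
  \<open>s / sqrt N\<close> into a bound on the \<open>N\<close>-th power in which \<open>N\<close>
  cancels. This uniformity is what dominated convergence requires.\<close>

lemma inverse_tilted_power_le:
  assumes "0 < q" "q < 1" "N > 0"
  shows "1 / tilted q (s / sqrt N) ^ N \<le> 1 / (1 + 2 * q\<^sup>2 * (1 - q)\<^sup>2 * s\<^sup>2)"
proof -
  define k where "k = 2 * q\<^sup>2 * (1 - q)\<^sup>2"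
  have k: "k \<ge> 0" using assms by (simp add: k_def)
  have "1 + k * s\<^sup>2 \<le> tilted q (s / sqrt N) ^ N" 
  proof -
    have "1 + k * s\<^sup>2 = 1 + real N * (k * (s / sqrt N)\<^sup>2)"
      using \<open>N > 0\<close> by (simp add: power_divide)
    also have "\<dots> \<le> (1 + k * (s / sqrt N)\<^sup>2) ^ N"
      using k by (intro Bernoulli_inequality order_trans[OF _ mult_nonneg_nonneg]) auto
    also have "\<dots> \<le> tilted q (s / sqrt N) ^ N"
      using k tilted_ge[OF assms(1,2), of "s / sqrt N"] by (intro power_mono) (auto simp: k_def)
    finally show ?thesis .
  qed
  then show ?thesis
    using k by (auto simp: k_def intro!: divide_left_mono mult_pos_pos zero_less_power tilted_pos assms(1,2) add_pos_nonneg)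
qed

text \<open>The logarithm of \<open>tilted q u\<close> starts with
  \<open>2 * q * (1 - q) * u\<^sup>2\<close>, half the variance of the centred variable times
  \<open>(2 * u)\<^sup>2\<close>. The limit of \<open>N\<close> times the logarithm is taken over
  real arguments and then restricted to naturals.\<close>

lemma tilted_power_tendsto:
  assumes "0 < q" "q < 1"
  shows "(\<lambda>N. tilted q (s / sqrt (real N)) ^ N) \<longlonglongrightarrow> exp (2 * q * (1 - q) * s\<^sup>2)"
proof -
  have lim: "((\<lambda>x::real. x * ln ((1 - q) * exp (- 2 * q * (s / sqrt x)) + q * exp (2 * (1 - q) * (s / sqrt x)))) \<longlongrightarrow>
      2 * q * (1 - q) * s\<^sup>2) at_top"
    using assms by (real_asymp simp: field_simps power2_eq_square)
  have "(\<lambda>N. exp (real N * ln (tilted q (s / sqrt (real N))))) \<longlonglongrightarrow> exp (2 * q * (1 - q) * s\<^sup>2)"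
    unfolding tilted_def
    by (intro tendsto_exp filterlim_compose[OF lim filterlim_real_sequentially])
  moreover have "exp (real N * ln (tilted q u)) = tilted q u ^ N" for N u
    using tilted_pos[OF assms] by (simp add: exp_of_nat_mult)
  ultimately show ?thesis by simp
qed

section \<open>Radial factors of the weight and their tilting\<close>

text \<open>
  The factor \<open>r ^ (2 * k) / (1 + r\<^sup>2) ^ (k + N + 1)\<close> of the weight at \<open>r = exp t\<close>.
\<close>

definition radial :: "nat \<Rightarrow> nat \<Rightarrow> real \<Rightarrow> real" where
  "radial k N t = exp (2 * t) ^ k / (1 + exp (2 * t)) ^ (k + N + 1)"

lemma radial_pos: "radial k N t > 0"
  by (simp add: radial_def add_pos_pos)

lemma radial_0_le_1: "radial k 0 t \<le> 1"
proof -
  have "exp (2 * t) ^ k \<le> (1 + exp (2 * t)) ^ k" by (intro power_mono) auto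
  also have "\<dots> \<le> (1 + exp (2 * t)) ^ (k + 1)" by (intro power_increasing) auto
  finally show ?thesis by (simp add: radial_def divide_le_eq add_pos_pos)
qed

text \<open>The slope of \<open>ln (1 + exp (2 * t))\<close> at \<open>t = c\<close> is
  \<open>2 * q\<close>. The ratio of \<open>1 + exp (2 * (c + u))\<close> to
  \<open>1 + exp (2 * c)\<close> is \<open>(1 - q) + q * exp (2 * u)\<close>, and removing this
  slope from it yields \<open>tilted q u\<close>. Only the power growing with \<open>N\<close> is
  tilted; the fixed powers stay in \<open>radial k 0\<close>.\<close>

lemma radial_tilt:
  assumes q: "q = exp (2 * c) / (1 + exp (2 * c))"
  shows "radial k N (c + u) =
    exp (- 2 * q * real N * u) / (1 + exp (2 * c)) ^ N * (radial k 0 (c + u) / tilted q u ^ N)"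
proof -
  have pos: "1 + exp (2 * c) > 0" by (simp add: add_pos_pos)
  have "1 - q = 1 / (1 + exp (2 * c))" using pos by (simp add: q field_simps)
  moreover have "tilted q u = exp (- 2 * q * u) * ((1 - q) + q * exp (2 * u))"
    by (simp add: tilted_def algebra_simps flip: exp_add)
  moreover have "1 / (1 + exp (2 * c)) + q * exp (2 * u) = (1 + exp (2 * (c + u))) / (1 + exp (2 * c))"
    by (simp add: q exp_add distrib_left add_divide_distrib)
  ultimately have t: "tilted q u = exp (- 2 * q * u) * ((1 + exp (2 * (c + u))) / (1 + exp (2 * c)))"
    by simp
  have "exp (- 2 * q * u) / (1 + exp (2 * c)) / tilted q u = 1 / (1 + exp (2 * (c + u)))"
    unfolding t using pos by (simp add: divide_simps)
  then have "(exp (- 2 * q * u) / (1 + exp (2 * c)) / tilted q u) ^ N = 1 / (1 + exp (2 * (c + u))) ^ N"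
    by (simp add: power_one_over)
  moreover have "exp (- 2 * q * u) ^ N = exp (- 2 * q * real N * u)"
    by (simp flip: exp_of_nat_mult add: algebra_simps)
  ultimately have "exp (- 2 * q * real N * u) / (1 + exp (2 * c)) ^ N / tilted q u ^ N =
      1 / (1 + exp (2 * (c + u))) ^ N"
    by (simp add: power_divide power_mult_distrib)
  moreover have "radial k N (c + u) = radial k 0 (c + u) * (1 / (1 + exp (2 * (c + u))) ^ N)"
    by (simp add: radial_def power_add)
  ultimately show ?thesis by (metis (no_types, lifting) times_divide_eq_left times_divide_eq_right mult.commute)
qed

text \<open>All factors are tilted with the same \<open>q\<close>, so their exponential prefactors
  combine to the exponential of a multiple of the sum of the \<open>u j\<close>, which is 0.\<close>

lemma prod_radial_tilt:
  assumes q: "q = exp (2 * c) / (1 + exp (2 * c))" and "finite A" and "(\<Sum>j\<in>A. u j) = 0"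
  shows "(\<Prod>j\<in>A. radial (\<nu> j) N (c + u j)) =
    (1 / (1 + exp (2 * c)) ^ (card A * N)) * (\<Prod>j\<in>A. radial (\<nu> j) 0 (c + u j) / tilted q (u j) ^ N)"
proof -
  have "(\<Prod>j\<in>A. exp (- 2 * q * real N * u j)) = exp (\<Sum>j\<in>A. - 2 * q * real N * u j)"
    using \<open>finite A\<close> by (simp add: exp_sum)
  also have "(\<Sum>j\<in>A. - 2 * q * real N * u j) = 0"
    using assms(3) by (simp only: flip: sum_distrib_left)
  finally have "(\<Prod>j\<in>A. exp (- 2 * q * real N * u j)) = 1" by simp
  then show ?thesis
    by (subst prod.cong[OF refl radial_tilt[OF q]])
       (simp add: prod.distrib prod_dividef mult.commute flip: power_mult)
qed


section \<open>Rescaled logarithmic coordinates: majorants, limits and an exact formula for the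
  weight\<close>

lemma integrable_inverse_1_plus_mult_square:
  assumes k: "k > 0"
  shows "integrable lborel (\<lambda>s::real. 1 / (1 + k * s\<^sup>2))"
proof -
  have "integrable lborel (\<lambda>s::real. inverse (1 + s\<^sup>2))"
    using integrable_inverse_1_plus_square by (simp add: set_integrable_def)
  then have "integrable lborel (\<lambda>s::real. inverse (1 + (0 + sqrt k * s)\<^sup>2))"
    using k by (intro lborel_integrable_real_affine) auto
  then show ?thesis using k by (simp add: power_mult_distrib inverse_eq_divide)
qed

text \<open>Here \<open>exp u\<close> stands for the eliminated radius, so that
  \<open>exp u * P\<close> is \<open>cmod z\<close>. The exponents \<open>- 2 * int k\<close> cancel
  \<open>P ^ (2 * k)\<close> from the power of \<open>cmod z\<close>, and the exponents
  \<open>- 1\<close> cancel the Jacobian \<open>P\<close>, leaving the eliminated radius on the same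
  footing as the others.\<close>

lemma integrand_exp_coordinates:
  fixes t :: "'i \<Rightarrow> real"
  assumes "finite I"
  defines "P \<equiv> \<Prod>j\<in>I. exp (t j)"
  shows "(exp u * P) ^ (2 * k) / (1 + (exp u * P)\<^sup>2 / (\<Prod>j\<in>I. (exp (t j))\<^sup>2)) ^ (k + N + 1) *
      (\<Prod>j\<in>I. exp (t j) powi (2 * int (\<nu> j) - 2 * int k - 1) / (1 + (exp (t j))\<^sup>2) ^ (\<nu> j + N + 1)) * P =
    radial k N u * (\<Prod>j\<in>I. radial (\<nu> j) N (t j))"
proof -
  have P: "P > 0" by (simp add: P_def prod_pos)
  have fac: "exp x powi (2 * int m - 2 * int k - 1) / (1 + (exp x)\<^sup>2) ^ (m + N + 1) * exp x =
      radial m N x / exp x ^ (2 * k)" for x :: real and m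
  proof -
    have "exp x powi (2 * int m - 2 * int k - 1) = exp x powi int (2 * m) / exp x powi int (2 * k) / exp x"
      by (simp add: power_int_diff)
    then have "exp x powi (2 * int m - 2 * int k - 1) * exp x = exp (2 * x) ^ m / exp x ^ (2 * k)"
      by (simp add: power_mult exp_double power_int_def nat_mult_distrib)
    then show ?thesis by (simp add: radial_def exp_double divide_simps)
  qed
  have "(\<Prod>j\<in>I. exp (t j) powi (2 * int (\<nu> j) - 2 * int k - 1) / (1 + (exp (t j))\<^sup>2) ^ (\<nu> j + N + 1)) * P =
      (\<Prod>j\<in>I. radial (\<nu> j) N (t j)) / P ^ (2 * k)"
    unfolding P_def prod.distrib[symmetric] fac by (simp add: prod_dividef prod_power_distrib)
  moreover have "(\<Prod>j\<in>I. (exp (t j))\<^sup>2) = P\<^sup>2"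
    by (simp add: P_def prod_power_distrib)
  then have "(exp u * P)\<^sup>2 / (\<Prod>j\<in>I. (exp (t j))\<^sup>2) = exp (2 * u)"
    using P by (simp add: power_mult_distrib exp_double)
  moreover have "(exp u * P) ^ (2 * k) = exp (2 * u) ^ k * P ^ (2 * k)"
    by (simp add: power_mult_distrib power_mult exp_double)
  ultimately show ?thesis
    using P by (simp add: radial_def mult.assoc)
qed

text \<open>What is left of \<open>radial k N\<close> at \<open>c + s / sqrt N\<close> once the
  prefactors in \<open>radial_tilt\<close> are pulled out.\<close>

definition rescaled :: "real \<Rightarrow> real \<Rightarrow> nat \<Rightarrow> nat \<Rightarrow> real \<Rightarrow> real" where
  "rescaled c q k N s = radial k 0 (c + s / sqrt (real N)) / tilted q (s / sqrt (real N)) ^ N"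

lemma rescaled_measurable [measurable]: "rescaled c q k N \<in> borel_measurable borel"
  unfolding rescaled_def radial_def tilted_def by measurable

lemma rescaled_nonneg:
  assumes "0 < q" "q < 1"
  shows "rescaled c q k N s \<ge> 0"
  using tilted_pos[OF assms] by (simp add: rescaled_def less_imp_le radial_pos)

lemma rescaled_le:
  assumes "0 < q" "q < 1" "N > 0"
  shows "rescaled c q k N s \<le> 1 / (1 + 2 * q\<^sup>2 * (1 - q)\<^sup>2 * s\<^sup>2)"
proof -
  have "rescaled c q k N s \<le> 1 / tilted q (s / sqrt N) ^ N"
    unfolding rescaled_def using tilted_pos[OF assms(1,2)]
    by (intro divide_right_mono radial_0_le_1) (simp add: less_imp_le)
  also have "\<dots> \<le> 1 / (1 + 2 * q\<^sup>2 * (1 - q)\<^sup>2 * s\<^sup>2)"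
    by (rule inverse_tilted_power_le[OF assms])
  finally show ?thesis .
qed

lemma rescaled_tendsto:
  assumes "0 < q" "q < 1"
  shows "(\<lambda>N. rescaled c q k N s) \<longlonglongrightarrow> radial k 0 c * exp (- (2 * q * (1 - q) * s\<^sup>2))"
proof -
  have s0: "(\<lambda>N. s / sqrt (real N)) \<longlonglongrightarrow> 0" by real_asymp
  have "isCont (radial k 0) c"
    unfolding radial_def by (intro continuous_intros) (simp add: add_pos_pos less_imp_neq[symmetric])
  moreover have "(\<lambda>N. c + s / sqrt (real N)) \<longlonglongrightarrow> c"
    using tendsto_add[OF tendsto_const[of c] s0] by simp
  ultimately have "(\<lambda>N. radial k 0 (c + s / sqrt (real N))) \<longlonglongrightarrow> radial k 0 c"
    by (rule isCont_tendsto_compose)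
  from tendsto_divide[OF this tilted_power_tendsto[OF assms, of s]] show ?thesis
    by (simp add: rescaled_def exp_minus divide_inverse)
qed

lemma borel_measurable_power_int [measurable (raw)]:
  fixes f :: "'a \<Rightarrow> real"
  assumes "f \<in> borel_measurable M"
  shows "(\<lambda>x. f x powi k) \<in> borel_measurable M"
  using assms by (cases "k \<ge> 0") (simp_all add: power_int_def)

text \<open>An exact identity for each positive \<open>N\<close>. The integrands are nonnegative, so
  the substitution is carried out on nonnegative integrals and transferred back without first
  proving integrability.\<close>

lemma omega_eq_rescaled:
  assumes n: "n \<ge> 1" and z: "z \<noteq> 0" and N: "N > 0"
    and c: "c = ln (cmod z) / real n" and q: "q = exp (2 * c) / (1 + exp (2 * c))"
  shows "omega n \<nu> N z = (2 * pi / sqrt (real N)) ^ (n - 1) / (1 + exp (2 * c)) ^ (n * N) *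
     (LINT s|(\<Pi>\<^sub>M j\<in>{1..n-1}. lborel).
        rescaled c q (\<nu> n) N (- (\<Sum>j\<in>{1..n-1}. s j)) * (\<Prod>j\<in>{1..n-1}. rescaled c q (\<nu> j) N (s j)))"
proof -
  define I where "I = {1..n-1}"
  have I: "finite I" "card I = n - 1" "n \<notin> I" "insert n I = {1..n}" using n by (auto simp: I_def)
  let ?M = "\<Pi>\<^sub>M j\<in>I. lborel :: real measure"
  have [measurable]: "(\<lambda>x. x j) \<in> borel_measurable ?M"
    if "j \<in> I" for j using measurable_component_singleton[OF that, of "\<lambda>_. lborel"] by simp
  define \<sigma> where "\<sigma> = 1 / sqrt (real N)"
  have \<sigma>: "\<sigma> > 0" using N by (simp add: \<sigma>_def)
  have q01: "0 < q" "q < 1" by (auto simp: q add_pos_pos)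
  define F where "F r = cmod z ^ (2 * \<nu> n) / (1 + (cmod z)\<^sup>2 / (\<Prod>j\<in>I. (r j)\<^sup>2)) ^ (\<nu> n + N + 1) *
        (\<Prod>j\<in>I. r j powi (2 * int (\<nu> j) - 2 * int (\<nu> n) - 1) / (1 + (r j)\<^sup>2) ^ (\<nu> j + N + 1))"
    for r :: "nat \<Rightarrow> real"
  define G where "G s = rescaled c q (\<nu> n) N (- (\<Sum>j\<in>I. s j)) * (\<Prod>j\<in>I. rescaled c q (\<nu> j) N (s j))"
    for s :: "nat \<Rightarrow> real"
  define K where "K = \<sigma> ^ card I / (1 + exp (2 * c)) ^ (n * N)"
  have K: "K \<ge> 0" using \<sigma> by (simp add: K_def add_nonneg_nonneg)
  have [measurable]: "F \<in> borel_measurable ?M" unfolding F_def by measurable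
  have [measurable]: "G \<in> borel_measurable ?M" unfolding G_def by measurable
  have G0: "G s \<ge> 0" for s
    unfolding G_def by (intro mult_nonneg_nonneg prod_nonneg ballI rescaled_nonneg q01)
  have Fpos: "F r \<ge> 0" if "\<And>j. j \<in> I \<Longrightarrow> r j > 0" for r
    unfolding F_def using that
    by (intro mult_nonneg_nonneg prod_nonneg divide_nonneg_nonneg zero_le_power add_nonneg_nonneg)
       (auto intro: less_imp_le)
  have FG: "F (\<lambda>j\<in>I. exp (c + \<sigma> * s j)) * (\<Prod>j\<in>I. \<sigma> * exp (c + \<sigma> * s j)) = K * G s" for s
  proof -
    define S where "S = (\<Sum>j\<in>I. s j)"
    \<comment> \<open>Index \<open>n\<close> receives minus the sum of the free coordinates, so that
      all \<open>n\<close> displacements sum to 0 and the integrand becomes a product over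
      \<open>{1..n}\<close>.\<close>
    define u where "u j = (if j = n then - S else s j) / sqrt (real N)" for j
    have uI: "u j = s j / sqrt (real N)" if "j \<in> I" for j using that I by (auto simp: u_def)
    have un: "u n = - S / sqrt (real N)" by (simp add: u_def)
    have sum0: "(\<Sum>j\<in>{1..n}. u j) = 0"
      using I(1,3) unfolding I(4)[symmetric] by (simp add: un uI S_def flip: sum_divide_distrib)
    \<comment> \<open>The constraint that the \<open>n\<close> radii multiply to
      \<open>cmod z\<close>; it fixes \<open>c\<close> as their common logarithm at zero
      displacement.\<close>
    have "cmod z = exp (real n * c)" using z n by (simp add: c)
    also have "real n * c = (c + u n) + (\<Sum>j\<in>I. c + u j)"
      using sum0 I(1-3) n unfolding I(4)[symmetric] by (simp add: sum.distrib of_nat_diff algebra_simps)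
    finally have zP: "cmod z = exp (c + u n) * (\<Prod>j\<in>I. exp (c + u j))"
      using I by (simp only: exp_add exp_sum)
    have r: "(\<lambda>j\<in>I. exp (c + \<sigma> * s j)) j = exp (c + u j)" if "j \<in> I" for j
      using that by (simp add: uI \<sigma>_def)
    have "F (\<lambda>j\<in>I. exp (c + \<sigma> * s j)) = F (\<lambda>j. exp (c + u j))"
      unfolding F_def by (simp only: r cong: prod.cong)
    moreover have "(\<Prod>j\<in>I. \<sigma> * exp (c + \<sigma> * s j)) = \<sigma> ^ card I * (\<Prod>j\<in>I. exp (c + u j))"
      using r by (simp add: prod.distrib cong: prod.cong)
    ultimately have "F (\<lambda>j\<in>I. exp (c + \<sigma> * s j)) * (\<Prod>j\<in>I. \<sigma> * exp (c + \<sigma> * s j)) =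
        \<sigma> ^ card I * (F (\<lambda>j. exp (c + u j)) * (\<Prod>j\<in>I. exp (c + u j)))"
      by simp
    also have "F (\<lambda>j. exp (c + u j)) * (\<Prod>j\<in>I. exp (c + u j)) =
        radial (\<nu> n) N (c + u n) * (\<Prod>j\<in>I. radial (\<nu> j) N (c + u j))"
      unfolding F_def zP by (rule integrand_exp_coordinates[OF I(1)])
    also have "\<dots> = (\<Prod>j\<in>{1..n}. radial (\<nu> j) N (c + u j))"
      using I(1,3) unfolding I(4)[symmetric] by simp
    also have "\<dots> = (1 / (1 + exp (2 * c)) ^ (n * N)) *
        (\<Prod>j\<in>{1..n}. radial (\<nu> j) 0 (c + u j) / tilted q (u j) ^ N)"
      by (subst prod_radial_tilt[OF q _ sum0]) auto
    also have "(\<Prod>j\<in>{1..n}. radial (\<nu> j) 0 (c + u j) / tilted q (u j) ^ N) = G s"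
      using I(1,3) unfolding I(4)[symmetric] G_def by (simp add: uI un S_def rescaled_def cong: prod.cong)
    finally show ?thesis unfolding K_def by (simp only: times_divide_eq_left times_divide_eq_right mult_1 mult_1_right)
  qed
  \<comment> \<open>The restriction to the space matters: membership in the extensional product also
    demands the default value outside \<open>I\<close>, which the product of indicators does not
    see.\<close>
  have ind: "indicator (\<Pi>\<^sub>E j\<in>I. {0<..}) r = (\<Prod>j\<in>I. indicator {0<..} (r j) :: real)"
    if "r \<in> space ?M" for r
    using that I(1) by (auto simp: space_PiM indicator_def PiE_iff prod_zero_iff)
  have "(LINT r : (\<Pi>\<^sub>E j\<in>I. {0<..}) | ?M. F r) =
      (LINT r|?M. F r * (\<Prod>j\<in>I. indicator {0<..} (r j)))"
    unfolding set_lebesgue_integral_def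
    by (intro Bochner_Integration.integral_cong refl) (simp add: ind mult.commute)
  also have "\<dots> = enn2real (\<integral>\<^sup>+r. ennreal (F r * (\<Prod>j\<in>I. indicator {0<..} (r j))) \<partial>?M)"
  proof (intro integral_eq_nn_integral AE_I2)
    fix r :: "nat \<Rightarrow> real"
    show "0 \<le> F r * (\<Prod>j\<in>I. indicator {0<..} (r j))"
    proof (cases "\<forall>j\<in>I. r j > 0")
      case True
      then show ?thesis using Fpos[of r] by (auto intro!: mult_nonneg_nonneg prod_nonneg)
    next
      case False
      then obtain j where "j \<in> I" "\<not> r j > 0" by blast
      then have "(\<Prod>j\<in>I. indicator {0<..} (r j)) = (0::real)"
        using I(1) by (intro prod_zero bexI[of _ j]) auto
      then show ?thesis by simp
    qed
  qed measurable
  also have "(\<integral>\<^sup>+r. ennreal (F r * (\<Prod>j\<in>I. indicator {0<..} (r j))) \<partial>?M) =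
      (\<integral>\<^sup>+r. ennreal (F r) * (\<Prod>j\<in>I. indicator {0<..} (r j)) \<partial>?M)"
    by (intro nn_integral_cong)
       (simp add: ennreal_mult'' prod_nonneg ennreal_indicator flip: prod_ennreal)
  also have "\<dots> = (\<integral>\<^sup>+s. ennreal (F (\<lambda>j\<in>I. exp (c + \<sigma> * s j))) *
      (\<Prod>j\<in>I. ennreal (\<sigma> * exp (c + \<sigma> * s j))) \<partial>?M)"
    by (rule nn_integral_PiM_exp_affine_substitution[OF I(1) _ \<sigma>]) measurable
  also have "\<dots> = (\<integral>\<^sup>+s. ennreal (K * G s) \<partial>?M)"
    unfolding FG[symmetric] using \<sigma>
    by (intro nn_integral_cong) (simp add: prod_nonneg prod_ennreal flip: ennreal_mult'')
  also have "enn2real \<dots> = (LINT s|?M. K * G s)"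
    using K G0 by (intro integral_eq_nn_integral[symmetric]) auto
  finally have "(LINT r : (\<Pi>\<^sub>E j\<in>I. {0<..}) | ?M. F r) = K * (LINT s|?M. G s)" by simp
  then have "omega n \<nu> N z = (2 * pi) ^ (n - 1) * (K * (LINT s|?M. G s))"
    unfolding omega_def F_def I_def by simp
  then show ?thesis
    unfolding K_def I(2) \<sigma>_def G_def I_def[symmetric] by (simp add: power_divide)
qed

section \<open>Passage to the limit under the integral\<close>

lemma rescaled_integral_tendsto:
  fixes I :: "'i set"
  assumes I: "finite I" and q: "0 < q" "q < 1"
  shows "(\<lambda>N. LINT s|(\<Pi>\<^sub>M j\<in>I. lborel).
        rescaled c q k N (- (\<Sum>j\<in>I. s j)) * (\<Prod>j\<in>I. rescaled c q (\<nu> j) N (s j))) \<longlonglongrightarrow>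
     radial k 0 c * (\<Prod>j\<in>I. radial (\<nu> j) 0 c) *
       (sqrt (2 * pi / (4 * q * (1 - q))) ^ card I / sqrt (1 + real (card I)))"
proof -
  interpret product_sigma_finite "\<lambda>_::'i. lborel :: real measure" ..
  let ?M = "\<Pi>\<^sub>M j\<in>I. lborel :: real measure"
  have [measurable]: "(\<lambda>x. x j) \<in> borel_measurable ?M"
    if "j \<in> I" for j using measurable_component_singleton[OF that, of "\<lambda>_. lborel"] by simp
  \<comment> \<open>This is the second derivative of \<open>ln (1 + exp (2 * t))\<close> at
    \<open>t = c\<close>, when \<open>q\<close> is the value used in
    \<open>radial_tilt\<close>.\<close>
  define a where "a = 4 * q * (1 - q)"
  have a: "a > 0" using q unfolding a_def by (intro mult_pos_pos) auto
  define \<kappa> where "\<kappa> = 2 * q\<^sup>2 * (1 - q)\<^sup>2"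
  have \<kappa>: "\<kappa> > 0" using q unfolding \<kappa>_def by (intro mult_pos_pos zero_less_power) auto
  define W where "W = radial k 0 c * (\<Prod>j\<in>I. radial (\<nu> j) 0 c)"
  have W: "W \<ge> 0" unfolding W_def by (intro mult_nonneg_nonneg prod_nonneg less_imp_le radial_pos)
  \<comment> \<open>The terms \<open>1 *\<close> and \<open>0 +\<close> put the exponent in the
    shape of \<open>nn_integral_PiM_gaussian\<close> with \<open>b = 1\<close> and
    \<open>y = 0\<close>.\<close>
  define g where "g s = W * exp (- (a / 2 * ((\<Sum>j\<in>I. (s j)\<^sup>2) + 1 * (0 + (\<Sum>j\<in>I. s j))\<^sup>2)))"
    for s :: "'i \<Rightarrow> real"
  have [measurable]: "g \<in> borel_measurable ?M" unfolding g_def by measurable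
  have lim: "(\<lambda>N. rescaled c q k N (- (\<Sum>j\<in>I. s j)) * (\<Prod>j\<in>I. rescaled c q (\<nu> j) N (s j))) \<longlonglongrightarrow> g s" for s
  proof -
    have "(\<lambda>N. rescaled c q k N (- (\<Sum>j\<in>I. s j)) * (\<Prod>j\<in>I. rescaled c q (\<nu> j) N (s j))) \<longlonglongrightarrow>
        radial k 0 c * exp (- (2 * q * (1 - q) * (- (\<Sum>j\<in>I. s j))\<^sup>2)) *
        (\<Prod>j\<in>I. radial (\<nu> j) 0 c * exp (- (2 * q * (1 - q) * (s j)\<^sup>2)))"
      by (intro tendsto_mult tendsto_prod rescaled_tendsto q)
    also have "(\<Prod>j\<in>I. radial (\<nu> j) 0 c * exp (- (2 * q * (1 - q) * (s j)\<^sup>2))) =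
        (\<Prod>j\<in>I. radial (\<nu> j) 0 c) * exp (- (2 * q * (1 - q) * (\<Sum>j\<in>I. (s j)\<^sup>2)))"
      by (simp only: prod.distrib exp_sum[OF I, symmetric] sum_distrib_left sum_negf)
    also have "radial k 0 c * exp (- (2 * q * (1 - q) * (- (\<Sum>j\<in>I. s j))\<^sup>2)) * \<dots> = g s"
    proof -
      have "a / 2 = 2 * q * (1 - q)" by (simp add: a_def)
      then show ?thesis
        by (simp only: g_def W_def distrib_left minus_add_distrib exp_add) simp
    qed
    finally show ?thesis .
  qed
  \<comment> \<open>The index is shifted because the majorant of \<open>rescaled_le\<close> is
    available for positive \<open>N\<close> only.\<close>
  have "(\<lambda>N. LINT s|?M. rescaled c q k (Suc N) (- (\<Sum>j\<in>I. s j)) * (\<Prod>j\<in>I. rescaled c q (\<nu> j) (Suc N) (s j)))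
      \<longlonglongrightarrow> (LINT s|?M. g s)"
  proof (rule integral_dominated_convergence)
    show "integrable ?M (\<lambda>s. \<Prod>j\<in>I. 1 / (1 + \<kappa> * (s j)\<^sup>2))"
      by (intro product_integrable_prod I integrable_inverse_1_plus_mult_square \<kappa>)
    show "AE s in ?M. (\<lambda>N. rescaled c q k (Suc N) (- (\<Sum>j\<in>I. s j)) *
        (\<Prod>j\<in>I. rescaled c q (\<nu> j) (Suc N) (s j))) \<longlonglongrightarrow> g s"
      by (intro AE_I2 LIMSEQ_Suc lim)
    fix N
    show "AE s in ?M. norm (rescaled c q k (Suc N) (- (\<Sum>j\<in>I. s j)) *
        (\<Prod>j\<in>I. rescaled c q (\<nu> j) (Suc N) (s j))) \<le> (\<Prod>j\<in>I. 1 / (1 + \<kappa> * (s j)\<^sup>2))"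
    proof (intro AE_I2)
      fix s :: "'i \<Rightarrow> real"
      \<comment> \<open>The factor in the dependent coordinate is bounded by 1; the other factors
        supply an integrable majorant that splits over the free coordinates.\<close>
      have "rescaled c q k (Suc N) x \<le> 1" for x
      proof -
        have "1 / (1 + 2 * q\<^sup>2 * (1 - q)\<^sup>2 * x\<^sup>2) \<le> 1" by (simp add: add_pos_nonneg)
        then show ?thesis using rescaled_le[OF q, of "Suc N" c k x] by simp
      qed
      then have "rescaled c q k (Suc N) (- (\<Sum>j\<in>I. s j)) * (\<Prod>j\<in>I. rescaled c q (\<nu> j) (Suc N) (s j)) \<le>
          1 * (\<Prod>j\<in>I. 1 / (1 + \<kappa> * (s j)\<^sup>2))"
        unfolding \<kappa>_def
        by (intro mult_mono prod_mono conjI rescaled_le rescaled_nonneg prod_nonneg q) auto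
      then show "norm (rescaled c q k (Suc N) (- (\<Sum>j\<in>I. s j)) *
        (\<Prod>j\<in>I. rescaled c q (\<nu> j) (Suc N) (s j))) \<le> (\<Prod>j\<in>I. 1 / (1 + \<kappa> * (s j)\<^sup>2))"
        by (simp add: abs_of_nonneg mult_nonneg_nonneg prod_nonneg rescaled_nonneg q)
    qed
  qed measurable
  moreover have "(LINT s|?M. g s) = W * (sqrt (2 * pi / a) ^ card I / sqrt (1 + real (card I)))"
  proof -
    have "(LINT s|?M. g s) = enn2real (\<integral>\<^sup>+s. ennreal (g s) \<partial>?M)"
      using W by (intro integral_eq_nn_integral) (auto simp: g_def)
    also have "(\<integral>\<^sup>+s. ennreal (g s) \<partial>?M) = ennreal W *
        ennreal (sqrt (2 * pi / a) ^ card I / sqrt (1 + real (card I) * 1) *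
            exp (- (a / 2 * (1 / (1 + real (card I) * 1) * 0\<^sup>2))))"
      unfolding g_def ennreal_mult[OF W exp_ge_zero]
      by (subst nn_integral_cmult) (measurable, simp only: nn_integral_PiM_gaussian[OF I a zero_le_one])
    also have "\<dots> = ennreal (W * (sqrt (2 * pi / a) ^ card I / sqrt (1 + real (card I))))"
      using W a by (subst ennreal_mult) auto
    finally show ?thesis using W a by simp
  qed
  ultimately show ?thesis
    unfolding W_def a_def by - (rule LIMSEQ_imp_Suc, simp)
qed

section \<open>The asymptotic formula: assembling the constants\<close>

theorem lemma3p3:
  fixes n :: nat and \<nu> :: "nat \<Rightarrow> nat" and \<alpha> :: nat and z :: complex
  assumes "n \<ge> 1"
    and "\<nu> 1 = 0"
    and "mono_on {1..n} \<nu>"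
    and "\<alpha> = (\<Sum>i=1..n. \<nu> i)"
    and "z \<noteq> 0 \<or> n = 1"
  shows "(\<lambda>N. omega n \<nu> N z) \<sim>[at_top]
    (\<lambda>N. (2 * pi) powr (3 / 2 * (real n - 1)) /
           (2 ^ (n - 1) * real N powr ((real n - 1) / 2) * sqrt (real n)) *
         (rpow (cmod z) ((1 - real n + 2 * real \<alpha>) / real n) /
           (1 + cmod z powr (2 / real n)) ^ (n * N + \<alpha> + 1)))"
proof (cases "n = 1")
  case True
  have \<alpha>: "\<alpha> = 0" using assms(2,4) True by simp
  have "(cmod z) powr 2 = (cmod z)\<^sup>2" by (cases "z = 0") (simp_all add: powr_numeral)
  \<comment> \<open>For \<open>n = 1\<close> both sides agree for every positive \<open>N\<close>;
    at \<open>N = 0\<close> the factor \<open>0 powr 0 = 0\<close> would spoil this. The exponent of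
    \<open>cmod z\<close> is 0, and \<open>rpow\<close> gives 1 even at
    \<open>z = 0\<close>.\<close>
  then show ?thesis
    using True assms(2)
    by (intro asymp_equiv_refl_ev eventually_mono[OF eventually_gt_at_top[of 0]])
       (use omega_1[of \<nu> _ z] in \<open>simp add: \<alpha> rpow_def\<close>)
next
  case False
  then have n: "n \<ge> 2" and z: "z \<noteq> 0" using assms(1,5) by auto
  define I where "I = {1..n-1}"
  have I: "finite I" "card I = n - 1" "n \<notin> I" "insert n I = {1..n}" using n by (auto simp: I_def)
  define c where "c = ln (cmod z) / real n"
  define E where "E = exp (2 * c)"
  define q where "q = E / (1 + E)"
  have E: "E > 0" by (simp add: E_def)
  have q01: "0 < q" "q < 1" using E by (auto simp: q_def)
  define J where "J N = (LINT s|(\<Pi>\<^sub>M j\<in>I. lborel).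
        rescaled c q (\<nu> n) N (- (\<Sum>j\<in>I. s j)) * (\<Prod>j\<in>I. rescaled c q (\<nu> j) N (s j)))" for N
  define A where "A = radial (\<nu> n) 0 c * (\<Prod>j\<in>I. radial (\<nu> j) 0 c) *
       (sqrt (2 * pi / (4 * q * (1 - q))) ^ (n - 1) / sqrt (real n))"
  have "J \<longlonglongrightarrow> A"
    using rescaled_integral_tendsto[OF I(1) q01, of c "\<nu> n" \<nu>] n
    unfolding I(2) by (simp add: J_def[abs_def] A_def of_nat_diff)
  moreover have "A \<noteq> 0"
    using q01 n I(1) by (auto simp: A_def radial_pos[THEN less_imp_neq, symmetric])
  ultimately have JA: "J \<sim>[at_top] (\<lambda>_. A)" by (rule tendsto_imp_asymp_equiv_const)
  define B where "B N = (2 * pi / sqrt (real N)) ^ (n - 1) / (1 + E) ^ (n * N)" for N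
  have "(\<lambda>N. B N * J N) \<sim>[at_top] (\<lambda>N. B N * A)"
    by (intro asymp_equiv_mult asymp_equiv_refl JA)
  moreover have "\<forall>\<^sub>F N in at_top. B N * J N = omega n \<nu> N z"
    using eventually_gt_at_top[of 0]
  proof eventually_elim
    case (elim N)
    have "q = exp (2 * c) / (1 + exp (2 * c))" by (simp add: q_def E_def)
    from omega_eq_rescaled[OF assms(1) z elim c_def this] show ?case
      by (simp add: B_def J_def E_def I_def)
  qed
  moreover have "\<forall>\<^sub>F N in at_top. B N * A = (2 * pi) powr (3 / 2 * (real n - 1)) /
           (2 ^ (n - 1) * real N powr ((real n - 1) / 2) * sqrt (real n)) *
         (rpow (cmod z) ((1 - real n + 2 * real \<alpha>) / real n) /
           (1 + cmod z powr (2 / real n)) ^ (n * N + \<alpha> + 1))"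
    using eventually_gt_at_top[of 0]
  proof eventually_elim
    case (elim N)
    define m where "m = n - 1"
    have m: "n = Suc m" "real n - 1 = real m" using n by (auto simp: m_def)
    have half: "x powr (real m / 2) = sqrt x ^ m" if "x > 0" for x :: real
      using that by (simp add: powr_half_sqrt[symmetric] powr_powr flip: powr_realpow)
    \<comment> \<open>The angular integrals contribute \<open>(2 * pi) ^ m\<close> and the Gaussian
      integral \<open>sqrt (2 * pi) ^ m\<close>.\<close>
    have pi: "(2 * pi) powr (3 / 2 * real m) = (2 * pi) ^ m * sqrt (2 * pi) ^ m"
    proof -
      have "(2 * pi) powr (3 / 2 * real m) = (2 * pi) powr (real m + real m / 2)" by (simp add: field_simps)
      then show ?thesis by (simp only: powr_add) (simp add: half powr_realpow)
    qed
    have zE: "cmod z powr (2 / real n) = E"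
      using z by (simp add: powr_def E_def c_def)
    have rp: "rpow (cmod z) ((1 - real n + 2 * real \<alpha>) / real n) = E ^ \<alpha> / exp c ^ m"
    proof -
      have "rpow (cmod z) ((1 - real n + 2 * real \<alpha>) / real n) = exp ((1 - real n + 2 * real \<alpha>) * c)"
        using z n by (auto simp: rpow_def powr_def c_def)
      also have "(1 - real n + 2 * real \<alpha>) * c = real \<alpha> * (2 * c) - real m * c"
        by (simp add: m(2)[symmetric] algebra_simps)
      finally show ?thesis by (simp add: exp_diff exp_of_nat_mult E_def)
    qed
    have W: "radial (\<nu> n) 0 c * (\<Prod>j\<in>I. radial (\<nu> j) 0 c) = E ^ \<alpha> / (1 + E) ^ (\<alpha> + n)"
    proof -
      have "radial (\<nu> n) 0 c * (\<Prod>j\<in>I. radial (\<nu> j) 0 c) = (\<Prod>j\<in>{1..n}. E ^ \<nu> j / (1 + E) ^ (\<nu> j + 1))"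
        using I(1,3) unfolding I(4)[symmetric] by (simp add: radial_def E_def)
      also have "\<dots> = E ^ \<alpha> / (1 + E) ^ (\<Sum>j\<in>{1..n}. \<nu> j + 1)"
        by (simp add: prod_dividef power_sum assms(4) del: power_Suc)
      also have "(\<Sum>j\<in>{1..n}. \<nu> j + 1) = \<alpha> + n" by (simp add: sum.distrib assms(4) del: add_Suc_right)
      finally show ?thesis .
    qed
    \<comment> \<open>With \<open>E = (exp c)\<^sup>2\<close> the product
      \<open>4 * q * (1 - q)\<close> is a perfect square, so the Gaussian width is rational in
      \<open>exp c\<close>.\<close>
    have Q: "sqrt (2 * pi / (4 * q * (1 - q))) = sqrt (2 * pi) * (1 + E) / (2 * exp c)"
    proof -
      have "1 - q = 1 / (1 + E)" using E by (simp add: q_def field_simps)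
      then have "4 * q * (1 - q) = (2 * exp c / (1 + E))\<^sup>2"
        by (simp add: q_def power_divide power_mult_distrib power2_eq_square[of "1 + E"])
          (simp add: E_def exp_double)
      then show ?thesis
        using E by (simp add: real_sqrt_divide)
    qed
    have "B N * A = (2 * pi) ^ m / sqrt (real N) ^ m / (1 + E) ^ (n * N) *
        (E ^ \<alpha> / (1 + E) ^ (\<alpha> + n) * (sqrt (2 * pi) ^ m * (1 + E) ^ m / (2 ^ m * exp c ^ m) / sqrt (real n)))"
      unfolding A_def W Q B_def m_def[symmetric] by (simp add: power_divide power_mult_distrib)
    also have "\<dots> = (2 * pi) ^ m * sqrt (2 * pi) ^ m / (2 ^ m * sqrt (real N) ^ m * sqrt (real n)) *
        (E ^ \<alpha> / exp c ^ m * ((1 + E) ^ m / ((1 + E) ^ (n * N) * (1 + E) ^ (\<alpha> + n))))"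
      by (simp add: mult_ac)
    also have "(1 + E) ^ m / ((1 + E) ^ (n * N) * (1 + E) ^ (\<alpha> + n)) = 1 / (1 + E) ^ (n * N + \<alpha> + 1)"
    proof -
      \<comment> \<open>The \<open>m = n - 1\<close> powers of \<open>1 + E\<close> from the
        Gaussian widths lower the exponent \<alpha> + n to \<alpha> + 1.\<close>
      have "(1 + E) ^ (n * N) * (1 + E) ^ (\<alpha> + n) = (1 + E) ^ m * (1 + E) ^ (n * N + \<alpha> + 1)"
        unfolding power_add[symmetric] by (rule arg_cong[of _ _ "\<lambda>k. (1 + E) ^ k"]) (use m(1) in linarith)
      then show ?thesis using E by (simp add: add_pos_pos)
    qed
    finally show ?case
      unfolding m(2) zE rp pi m_def[symmetric] using elim by (simp add: half)
  qed
  ultimately show ?thesis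
    by (rule asymp_equiv_transfer)
qed

end
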